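(* The family of Knapsack polytopes admits no polynomial-size relaxation scheme in the original space. That is, it is not the case that for every $\varepsilon>0$ there exists a polynomial function $\phi:\mathbb{N}\to\mathbb{N}$ such that, for every $n$ and every Knapsack polytope $P\subseteq\mathbb{R}^n$, there is a polytope $Q\subseteq\mathbb{R}^n$ which is an $\varepsilon$-approximated formulation for $P$ and satisfies $\mathrm{size}(Q)\le\phi(n)$.
   Context: A Knapsack instance on $n$ objects consists of nonnegative real weights $w_1,\dots,w_n$ and a threshold $B\ge 0$. The corresponding Knapsack polytope is $P=\mathrm{conv}\{x\in\{0,1\}^n : \sum_{i=1}^n w_i x_i\le B\}\subseteq\mathbb{R}^n$. The family of Knapsack polytopes consists of all such $P$, over all $n$, all weights and all thresholds. Given a polytope $P\subseteq\mathbb{R}^n$ and $\varepsilon>0$, a set $Q\subseteq\mathbb{R}^n$ is an $\varepsilon$-approximated formulation for $P$ if $P\subseteq Q$ and for each $c\in\mathbb{R}^n$, $$\max\{cx : x\in P\}\ \ge\ (1-\varepsilon)\max\{cx : x\in Q\}.$$ For a polytope $Q\subseteq\mathbb{R}^n$, $\mathrm{size}(Q)$ denotes the number of inequalities in a minimum linear description of $Q$ in $\mathbb{R}^n$ (i.e. the number of facets of $Q$). A family $\mathcal{P}$ of polytopes has a polynomial-size relaxation scheme (PSRS) in the original space if for each $\varepsilon>0$ there exists a polynomial function $\phi:\mathbb{N}\to\mathbb{N}$ such that each $P\in\mathcal{P}$ with $P\subseteq\mathbb{R}^n$ has an $\varepsilon$-approximated formulation $Q\subseteq\mathbb{R}^n$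 with $\mathrm{size}(Q)\le\phi(n)$. *)

theory Defs
  imports "HOL-Analysis.Analysis" "HOL-Computational_Algebra.Polynomial"
    "HOL-Analysis.Finite_Function_Topology" "HOL-Library.Extended_Nat"
begin

(* The dimension n is quantified inside the statement, so R^n cannot be a type indexed by n.
   We embed every R^n into the real vector space of finitely supported real sequences, as
   the sequences vanishing from index n on (coordinates are numbered 0, ..., n - 1).
   The library notions "convex hull" and "polytope" only need a real vector space. *)

type_synonym rvec = "nat \<Rightarrow>\<^sub>0 real"

definition Rn :: "nat \<Rightarrow> rvec set" where
  "Rn n = {x. Poly_Mapping.keys x \<subseteq> {..<n}}"

definition dot :: "nat \<Rightarrow> rvec \<Rightarrow> rvec \<Rightarrow> real" where
  "dot n c x = (\<Sum>i<n. Poly_Mapping.lookup c i * Poly_Mapping.lookup x i)"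

definition knapsack_polytope :: "nat \<Rightarrow> (nat \<Rightarrow> real) \<Rightarrow> real \<Rightarrow> rvec set" where
  "knapsack_polytope n w B =
     convex hull {x \<in> Rn n. (\<forall>i<n. Poly_Mapping.lookup x i \<in> {0, 1}) \<and>
                            (\<Sum>i<n. w i * Poly_Mapping.lookup x i) \<le> B}"

(* A family of polytopes is a map sending n to the set of its members in R^n: the ambient
   dimension is part of the data, as Rn m is contained in Rn n for m \<le> n. *)

definition knapsack_family :: "nat \<Rightarrow> rvec set set" where
  "knapsack_family n =
     {knapsack_polytope n w B | w B. (\<forall>i<n. 0 \<le> w i) \<and> 0 \<le> B}"

(* The suprema are maxima for nonempty polytopes P and Q, the only case used below. *)

definition approx_formulation :: "nat \<Rightarrow> real \<Rightarrow> rvec set \<Rightarrow> rvec set \<Rightarrow> bool" where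
  "approx_formulation n \<epsilon> P Q \<longleftrightarrow>
     Q \<subseteq> Rn n \<and> P \<subseteq> Q \<and>
     (\<forall>c\<in>Rn n. (SUP x\<in>P. dot n c x) \<ge> (1 - \<epsilon>) * (SUP x\<in>Q. dot n c x))"

(* A pair (a, b) in E stands for the equation a x = b, and in I for the inequality a x \<le> b. *)

definition linear_description ::
  "nat \<Rightarrow> (rvec \<times> real) set \<Rightarrow> (rvec \<times> real) set \<Rightarrow> rvec set \<Rightarrow> bool" where
  "linear_description n E I Q \<longleftrightarrow>
     finite E \<and> finite I \<and> E \<subseteq> Rn n \<times> UNIV \<and> I \<subseteq> Rn n \<times> UNIV \<and>
     Q = {x \<in> Rn n. (\<forall>(a, b)\<in>E. dot n a x = b) \<and> (\<forall>(a, b)\<in>I. dot n a x \<le> b)}"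

(* Equations describing the affine hull are not counted, so that the minimum is the number
   of facets also when Q is not full-dimensional. For full-dimensional Q only trivial
   equations can occur. The value is \<infinity> if Q has no finite linear description, which does
   not happen for polytopes. *)

definition lin_size :: "nat \<Rightarrow> rvec set \<Rightarrow> enat" where
  "lin_size n Q = Inf {enat (card I) | E I. linear_description n E I Q}"

definition polynomial_function :: "(nat \<Rightarrow> nat) \<Rightarrow> bool" where
  "polynomial_function \<phi> \<longleftrightarrow> (\<exists>p :: real poly. \<forall>n. real (\<phi> n) = poly p (real n))"

definition has_PSRS :: "(nat \<Rightarrow> rvec set set) \<Rightarrow> bool" where
  "has_PSRS \<P> \<longleftrightarrow>
     (\<forall>\<epsilon>>0. \<exists>\<phi>. polynomial_function \<phi> \<and>
        (\<forall>n. \<forall>P\<in>\<P> n. \<exists>Q. polytope Q \<and> approx_formulation n \<epsilon> P Q \<and>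
                               lin_size n Q \<le> enat (\<phi> n)))"

end

theory Submission
  imports Defs "HOL-Real_Asymp.Real_Asymp"
begin

text \<open>
  Take one item of weight \<open>3 m\<close>, \<open>32 m\<close> items of weight \<open>1\<close> and threshold \<open>4 m\<close>. For a set
  \<open>S\<close> of \<open>2 m\<close> light items, the lifted inequality \<open>m x\<^sub>0 + x(S) \<le> 2 m\<close> is valid, while the
  point \<open>p\<^sub>S = e\<^sub>0 / 2 + 1\<^sub>S\<close> violates it by the factor \<open>5 / 4\<close>; hence every
  \<open>1 / 10\<close>-approximated formulation must cut off every \<open>p\<^sub>S\<close>.

  If \<open>\<bar>S \<inter> T\<bar> \<le> m\<close>, then \<open>p\<^sub>S + p\<^sub>T = 1\<^bsub>S \<union> T\<^esub> + (e\<^sub>0 + 1\<^bsub>S \<inter> T\<^esub>)\<close> is a sum of two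
  feasible points, so no valid inequality cuts off both \<open>p\<^sub>S\<close> and \<open>p\<^sub>T\<close>. Let \<open>S\<close> range over
  the graphs of the \<open>16\<^bsup>2 m\<^esup>\<close> functions from a set of size \<open>2 m\<close> to one of size \<open>16\<close>. The
  functions cut off by a single inequality agree pairwise in more than \<open>m\<close> places, so there are
  at most \<open>2\<^bsup>2 m\<^esup> 16\<^bsup>m\<^esup>\<close> of them, and at least \<open>4\<^bsup>m\<^esup>\<close> inequalities are needed. Equations
  cut off nothing, as \<open>p\<^sub>S\<close> is in the affine hull of the polytope.
\<close>

section \<open>Linear functionals, suprema and size\<close>

lemma dot_add: "dot n c (x + y) = dot n c x + dot n c y"
  by (simp add: dot_def lookup_add distrib_left sum.distrib)

lemma lookup_scaleR: "Poly_Mapping.lookup (r *\<^sub>R x) i = r * Poly_Mapping.lookup x i"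
proof -
  have "finite {i. r * Poly_Mapping.lookup x i \<noteq> 0}"
    by (rule finite_subset[OF _ finite_lookup[of x]]) auto
  then show ?thesis
    by (simp add: scaleR_poly_mapping_def)
qed

lemma dot_scaleR: "dot n c (r *\<^sub>R x) = r * dot n c x"
  by (simp add: dot_def lookup_scaleR sum_distrib_left mult.left_commute)

lemma linear_dot: "linear (dot n c)"
  by (simp add: linear_iff dot_add dot_scaleR)

lemma dot_le_convex_hull:
  assumes "\<And>v. v \<in> X \<Longrightarrow> dot n c v \<le> b" and "x \<in> convex hull X"
  shows "dot n c x \<le> b"
proof -
  have "{x. dot n c x \<le> b} = dot n c -` {..b}"
    by auto
  then have "convex {x. dot n c x \<le> b}"
    by (simp add: convex_linear_vimage linear_dot)
  then have "convex hull X \<subseteq> {x. dot n c x \<le> b}"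
    using assms(1) by (intro hull_minimal) auto
  then show ?thesis
    using assms(2) by auto
qed

text \<open>Real suprema are upper bounds only on bounded sets. Here a bound on the finitely many
  generating points extends to their hull.\<close>

lemma polytope_bdd_above_dot:
  assumes "polytope Q"
  shows "bdd_above (dot n c ` Q)"
proof -
  obtain V where V: "finite V" "Q = convex hull V"
    using assms by (auto simp: polytope_def)
  then have "bdd_above (dot n c ` V)"
    by simp
  then obtain b where "\<And>v. v \<in> V \<Longrightarrow> dot n c v \<le> b"
    by (auto simp: bdd_above_def)
  then have "\<And>x. x \<in> Q \<Longrightarrow> dot n c x \<le> b"
    using V(2) dot_le_convex_hull by blast
  then show ?thesis
    by (rule bdd_aboveI2)
qed

text \<open>A bound \<open>enat k\<close> rules out the empty set, whose infimum in
  \<open>enat\<close> is infinite, and a nonempty set of extended naturals attains its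
  infimum.\<close>

lemma lin_size_le_iff:
  "lin_size n Q \<le> enat k \<longleftrightarrow> (\<exists>E I. linear_description n E I Q \<and> card I \<le> k)"
proof
  let ?A = "{enat (card I) | E I. linear_description n E I Q}"
  assume *: "lin_size n Q \<le> enat k"
  then have "?A \<noteq> {}"
    unfolding lin_size_def by (metis (no_types, lifting) Inf_empty top_enat_def infinity_ileE)
  then have "Inf ?A \<in> ?A"
    by (metis (no_types, lifting) Inf_enat_def LeastI_ex all_not_in_conv)
  with * show "\<exists>E I. linear_description n E I Q \<and> card I \<le> k"
    unfolding lin_size_def by force
next
  assume "\<exists>E I. linear_description n E I Q \<and> card I \<le> k"
  then show "lin_size n Q \<le> enat k"
    unfolding lin_size_def by (auto intro!: Inf_lower2)
qed

text \<open>If \<open>p\<close> were in \<open>Q\<close>, the supremum of \<open>c\<close> over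
  \<open>Q\<close> would be at least the value at \<open>p\<close>, which even after scaling by
  \<open>1 - \<epsilon>\<close> exceeds every value on \<open>P\<close>.\<close>

lemma approx_formulation_excludes:
  assumes "approx_formulation n \<epsilon> P Q" and "polytope Q" and "P \<noteq> {}" and "\<epsilon> < 1"
    and "c \<in> Rn n" and "\<And>x. x \<in> P \<Longrightarrow> dot n c x \<le> b" and "b < (1 - \<epsilon>) * dot n c p"
  shows "p \<notin> Q"
proof
  assume "p \<in> Q"
  then have "dot n c p \<le> (SUP x\<in>Q. dot n c x)"
    using polytope_bdd_above_dot[OF assms(2)] by (intro cSUP_upper) auto
  then have "(1 - \<epsilon>) * dot n c p \<le> (1 - \<epsilon>) * (SUP x\<in>Q. dot n c x)"
    using assms(4) by (intro mult_left_mono) auto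
  also have "\<dots> \<le> (SUP x\<in>P. dot n c x)"
    using assms(1,5) by (auto simp: approx_formulation_def)
  also have "\<dots> \<le> b"
    using assms(3,6) by (intro cSUP_least) auto
  finally show False
    using assms(7) by simp
qed

section \<open>Vectors given by coordinates\<close>

definition rvec_of :: "nat \<Rightarrow> (nat \<Rightarrow> real) \<Rightarrow> rvec" where
  "rvec_of n f = Poly_Mapping.Abs_poly_mapping (\<lambda>i. if i < n then f i else 0)"

lemma lookup_rvec_of [simp]:
  "Poly_Mapping.lookup (rvec_of n f) i = (if i < n then f i else 0)"
  unfolding rvec_of_def by (subst lookup_Abs_poly_mapping) (auto intro: finite_subset[of _ "{..<n}"])

lemma rvec_of_in_Rn [simp]: "rvec_of n f \<in> Rn n"
  by (auto simp: Rn_def in_keys_iff split: if_splits)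

lemma dot_rvec_of: "dot n c (rvec_of n f) = (\<Sum>i<n. Poly_Mapping.lookup c i * f i)"
  by (simp add: dot_def)

lemma rvec_of_in_knapsack_polytope:
  assumes "\<And>i. i < n \<Longrightarrow> f i \<in> {0, 1}" and "(\<Sum>i<n. w i * f i) \<le> B"
  shows "rvec_of n f \<in> knapsack_polytope n w B"
  unfolding knapsack_polytope_def using assms by (intro hull_inc) auto

section \<open>Counting functions that agree in many places\<close>

text \<open>Such a function is determined by its restriction to \<open>K - T\<close>, a set of at
  most \<open>l\<close> elements.\<close>

lemma card_agreeing_le:
  fixes g :: "'a \<Rightarrow> 'b"
  assumes "finite K" and "finite A" and "A \<noteq> {}" and "T \<subseteq> K" and "card K \<le> card T + l"
  shows "card {h \<in> K \<rightarrow>\<^sub>E A. \<forall>i\<in>T. h i = g i} \<le> card A ^ l"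
proof -
  let ?X = "{h \<in> K \<rightarrow>\<^sub>E A. \<forall>i\<in>T. h i = g i}"
  have "inj_on (\<lambda>h. restrict h (K - T)) ?X"
  proof (rule inj_onI)
    fix h h' assume *: "h \<in> ?X" "h' \<in> ?X" "restrict h (K - T) = restrict h' (K - T)"
    show "h = h'"
    proof (rule PiE_ext[of _ K "\<lambda>_. A"])
      fix i assume "i \<in> K"
      then show "h i = h' i"
        using * by (cases "i \<in> T") (auto dest: fun_cong[of _ _ i])
    qed (use * in auto)
  qed
  then have "card ?X \<le> card ((K - T) \<rightarrow>\<^sub>E A)"
    using assms by (intro card_inj_on_le[where f="\<lambda>h. restrict h (K - T)"]) (auto intro!: finite_PiE)
  also have "\<dots> = card A ^ card (K - T)"
    using assms by (simp add: card_PiE)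
  also have "\<dots> \<le> card A ^ l"
  proof (rule power_increasing)
    show "card (K - T) \<le> l"
      using assms finite_subset[of T K] by (simp add: card_Diff_subset)
    show "1 \<le> card A"
      using assms by (simp add: Suc_le_eq card_gt_0_iff)
  qed
  finally show ?thesis .
qed

text \<open>Fix one member of \<open>C\<close>. Every member agrees with it on a set missing at most
  \<open>l\<close> places of \<open>K\<close>, so a union bound over the at most
  \<open>2 ^ card K\<close> such sets applies.\<close>

lemma card_intersecting_functions_le:
  assumes "finite K" and "finite A" and "A \<noteq> {}"
    and "C \<subseteq> K \<rightarrow>\<^sub>E A"
    and "\<And>g h. g \<in> C \<Longrightarrow> h \<in> C \<Longrightarrow> card K \<le> card {i\<in>K. g i = h i} + l"
  shows "card C \<le> 2 ^ card K * card A ^ l"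
proof (cases "C = {}")
  case False
  then obtain g where g: "g \<in> C"
    by auto
  let ?\<T> = "{T. T \<subseteq> K \<and> card K \<le> card T + l}"
  let ?X = "\<lambda>T. {h \<in> K \<rightarrow>\<^sub>E A. \<forall>i\<in>T. h i = g i}"
  have fin: "finite (K \<rightarrow>\<^sub>E A)"
    using assms by (intro finite_PiE) auto
  have fin\<T>: "finite ?\<T>"
    using assms(1) by simp
  have "C \<subseteq> (\<Union>T\<in>?\<T>. ?X T)"
  proof
    fix h assume h: "h \<in> C"
    then have "{i\<in>K. g i = h i} \<in> ?\<T>"
      using assms(5)[OF g h] by auto
    moreover have "h \<in> ?X {i\<in>K. g i = h i}"
      using h assms(4) by auto
    ultimately show "h \<in> (\<Union>T\<in>?\<T>. ?X T)"
      by blast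
  qed
  then have "card C \<le> card (\<Union>T\<in>?\<T>. ?X T)"
    using fin by (intro card_mono) (auto intro: finite_subset)
  also have "\<dots> \<le> (\<Sum>T\<in>?\<T>. card (?X T))"
    by (rule card_UN_le[OF fin\<T>])
  also have "\<dots> \<le> card ?\<T> * card A ^ l"
    using sum_bounded_above[of ?\<T> "\<lambda>T. card (?X T)" "card A ^ l"]
      card_agreeing_le[OF assms(1-3)] by simp
  also have "\<dots> \<le> card (Pow K) * card A ^ l"
    using assms(1) by (intro mult_right_mono card_mono) auto
  finally show ?thesis
    using assms(1) by (simp add: card_Pow)
qed simp

section \<open>Encoding functions as sets of light items\<close>

text \<open>The graph of \<open>g\<close>, with the pair \<open>(i, j)\<close> numbered \<open>1 + 16 i + j\<close> (item \<open>0\<close> is the heavy one).\<close>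

definition code_set :: "nat \<Rightarrow> (nat \<Rightarrow> nat) \<Rightarrow> nat set" where
  "code_set m g = (\<lambda>i. 1 + 16 * i + g i) ` {..<2 * m}"

lemma code_set:
  assumes "g \<in> {..<2 * m} \<rightarrow>\<^sub>E {..<16}"
  shows "code_set m g \<subseteq> {1..<32 * m + 1}" and "card (code_set m g) = 2 * m"
proof -
  have lt: "g i < 16" if "i < 2 * m" for i
    using assms that by auto
  show "code_set m g \<subseteq> {1..<32 * m + 1}"
    using lt by (fastforce simp: code_set_def)
  have "inj_on (\<lambda>i. 1 + 16 * i + g i) {..<2 * m}"
  proof (rule inj_onI)
    fix i j assume "i \<in> {..<2 * m}" "j \<in> {..<2 * m}" "1 + 16 * i + g i = 1 + 16 * j + g j"
    with lt[of i] lt[of j] show "i = j"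
      by auto
  qed
  then show "card (code_set m g) = 2 * m"
    by (simp add: code_set_def card_image)
qed

text \<open>As values are below 16, different \<open>i\<close> use disjoint blocks of items. A
  common item thus comes from the same \<open>i\<close> on both sides, with the same value.\<close>

lemma card_code_set_Int_le:
  assumes "g \<in> {..<2 * m} \<rightarrow>\<^sub>E {..<16}" and "h \<in> {..<2 * m} \<rightarrow>\<^sub>E {..<16}"
  shows "card (code_set m g \<inter> code_set m h) \<le> card {i \<in> {..<2 * m}. g i = h i}"
proof -
  have "code_set m g \<inter> code_set m h \<subseteq> (\<lambda>i. 1 + 16 * i + g i) ` {i \<in> {..<2 * m}. g i = h i}"
  proof
    fix x assume "x \<in> code_set m g \<inter> code_set m h"
    then obtain i j where ij: "i < 2 * m" "j < 2 * m" "x = 1 + 16 * i + g i" "x = 1 + 16 * j + h j"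
      by (auto simp: code_set_def)
    moreover have "g i < 16" "h j < 16"
      using ij(1,2) assms by auto
    ultimately have "i = j"
      by auto
    with ij have "g i = h i"
      by auto
    with ij show "x \<in> (\<lambda>i. 1 + 16 * i + g i) ` {i \<in> {..<2 * m}. g i = h i}"
      by auto
  qed
  then show ?thesis
    by (intro surj_card_le) auto
qed

section \<open>The hard instance\<close>

definition hard_weight :: "nat \<Rightarrow> nat \<Rightarrow> real" where
  "hard_weight m i = (if i = 0 then 3 * real m else 1)"

abbreviation hard_polytope :: "nat \<Rightarrow> rvec set" where
  "hard_polytope m \<equiv> knapsack_polytope (32 * m + 1) (hard_weight m) (4 * real m)"

text \<open>The parameter \<open>t\<close> has three uses: 0 or 1 for feasible points, 1/2 for the
  points to be cut off, and \<open>real m\<close> for the coefficients of the lifted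
  inequality.\<close>

definition pt :: "nat \<Rightarrow> real \<Rightarrow> nat set \<Rightarrow> rvec" where
  "pt m t S = rvec_of (32 * m + 1) (\<lambda>i. if i = 0 then t else indicator S i)"

lemma sum_split_0:
  fixes f :: "nat \<Rightarrow> real"
  shows "(\<Sum>i<32 * m + 1. f i) = f 0 + (\<Sum>i\<in>{1..<32 * m + 1}. f i)"
proof -
  have "{..<32 * m + 1} = insert 0 {1..<32 * m + 1}"
    by auto
  then show ?thesis
    by simp
qed

lemma dot_pt:
  assumes "S \<subseteq> {1..<32 * m + 1}"
  shows "dot (32 * m + 1) a (pt m t S) = Poly_Mapping.lookup a 0 * t + (\<Sum>i\<in>S. Poly_Mapping.lookup a i)"
proof -
  have "(\<Sum>i\<in>{1..<32 * m + 1}. Poly_Mapping.lookup a i * (if i = 0 then t else indicator S i))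
      = (\<Sum>i\<in>S. Poly_Mapping.lookup a i)"
    using assms by (intro sum.mono_neutral_cong_right) auto
  then show ?thesis
    unfolding pt_def dot_rvec_of sum_split_0 by simp
qed

lemma pt_in_hard_polytope:
  assumes "S \<subseteq> {1..<32 * m + 1}" and "t \<in> {0, 1}" and "3 * real m * t + card S \<le> 4 * real m"
  shows "pt m t S \<in> hard_polytope m"
  unfolding pt_def
proof (rule rvec_of_in_knapsack_polytope)
  have "(\<Sum>i\<in>{1..<32 * m + 1}. hard_weight m i * (if i = 0 then t else indicator S i)) = (\<Sum>i\<in>S. 1)"
    using assms(1) by (intro sum.mono_neutral_cong_right) (auto simp: hard_weight_def)
  then show "(\<Sum>i<32 * m + 1. hard_weight m i * (if i = 0 then t else indicator S i)) \<le> 4 * real m"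
    unfolding sum_split_0 using assms(3) by (simp add: hard_weight_def)
qed (use assms(2) in \<open>auto simp: indicator_def\<close>)

text \<open>At a feasible 0/1 point without item \<open>0\<close>, the bound is
  \<open>card S\<close>. With item \<open>0\<close>, capacity \<open>m\<close> remains, which gives
  \<open>m + m\<close>.\<close>

lemma hard_polytope_valid:
  assumes "S \<subseteq> {1..<32 * m + 1}" and "card S = 2 * m" and "x \<in> hard_polytope m"
  shows "dot (32 * m + 1) (pt m (real m) S) x \<le> 2 * real m"
  using _ assms(3)[unfolded knapsack_polytope_def]
proof (rule dot_le_convex_hull)
  let ?y = "Poly_Mapping.lookup"
  fix v assume "v \<in> {x \<in> Rn (32 * m + 1). (\<forall>i<32 * m + 1. ?y x i \<in> {0, 1}) \<and>
                            (\<Sum>i<32 * m + 1. hard_weight m i * ?y x i) \<le> 4 * real m}"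
  then have v01: "\<And>i. i < 32 * m + 1 \<Longrightarrow> ?y v i \<in> {0, 1}"
    and vB: "(\<Sum>i<32 * m + 1. hard_weight m i * ?y v i) \<le> 4 * real m"
    by auto
  have "(\<Sum>i\<in>{1..<32 * m + 1}. hard_weight m i * ?y v i) = (\<Sum>i\<in>{1..<32 * m + 1}. ?y v i)"
    by (intro sum.cong) (auto simp: hard_weight_def)
  with vB have B: "3 * real m * ?y v 0 + (\<Sum>i\<in>{1..<32 * m + 1}. ?y v i) \<le> 4 * real m"
    unfolding sum_split_0 by (simp add: hard_weight_def)
  have "(\<Sum>i\<in>S. ?y v i) \<le> (\<Sum>i\<in>{1..<32 * m + 1}. ?y v i)"
    using assms(1) v01 by (intro sum_mono2) force+
  moreover have "(\<Sum>i\<in>S. ?y v i) \<le> 2 * real m"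
    using assms(1,2) v01 sum_bounded_above[of S "?y v" 1] by force
  ultimately have "real m * ?y v 0 + (\<Sum>i\<in>S. ?y v i) \<le> 2 * real m"
    using B v01[of 0] by auto
  moreover have "(\<Sum>i\<in>{1..<32 * m + 1}. (if i = 0 then real m else indicator S i) * ?y v i)
      = (\<Sum>i\<in>S. ?y v i)"
    using assms(1) by (intro sum.mono_neutral_cong_right) auto
  ultimately show "dot (32 * m + 1) (pt m (real m) S) v \<le> 2 * real m"
    unfolding dot_def sum_split_0 by (simp add: pt_def)
qed

lemma hard_polytope_size:
  assumes "m > 0" and "polytope Q" and "approx_formulation (32 * m + 1) (1 / 10) (hard_polytope m) Q"
    and "linear_description (32 * m + 1) E I Q"
  shows "4 ^ m \<le> card I"
proof -
  let ?n = "32 * m + 1"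
  let ?G = "{..<2 * m} \<rightarrow>\<^sub>E {..<16::nat}"
  let ?p = "\<lambda>g. pt m (1 / 2) (code_set m g)"
  define C where "C = (\<lambda>(a, b). {g \<in> ?G. b < dot ?n a (?p g)})"
  have PQ: "hard_polytope m \<subseteq> Q"
    using assms(3) by (simp add: approx_formulation_def)
  have finI: "finite I"
    using assms(4) by (simp add: linear_description_def)
  have Q: "Q = {x \<in> Rn ?n. (\<forall>(a, b)\<in>E. dot ?n a x = b) \<and> (\<forall>(a, b)\<in>I. dot ?n a x \<le> b)}"
    using assms(4) by (simp add: linear_description_def)
  have zero: "pt m 0 {} \<in> hard_polytope m"
    by (intro pt_in_hard_polytope) auto
  have heavy: "pt m 1 {} \<in> hard_polytope m"
    by (intro pt_in_hard_polytope) auto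
  have outside: "?p g \<notin> Q" if "g \<in> ?G" for g
  proof (rule approx_formulation_excludes[OF assms(3,2), where c="pt m (real m) (code_set m g)" and b="2 * real m"])
    note S = code_set[OF that]
    have "(\<Sum>i\<in>code_set m g. Poly_Mapping.lookup (pt m (real m) (code_set m g)) i) = (\<Sum>i\<in>code_set m g. 1)"
      using S(1) by (intro sum.cong) (auto simp: pt_def)
    then have "dot ?n (pt m (real m) (code_set m g)) (?p g) = real m / 2 + 2 * real m"
      unfolding dot_pt[OF S(1)] using S(2) by (simp add: pt_def)
    \<comment> \<open>The value is \<open>5 m / 2\<close>, and \<open>9 / 10\<close> of it is
      \<open>9 m / 4 > 2 m\<close>, as \<open>m > 0\<close>.\<close>
    then show "2 * real m < (1 - 1 / 10) * dot ?n (pt m (real m) (code_set m g)) (?p g)"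
      using assms(1) by simp
    show "dot ?n (pt m (real m) (code_set m g)) x \<le> 2 * real m" if "x \<in> hard_polytope m" for x
      using hard_polytope_valid[OF S that] .
  qed (use zero in \<open>auto simp: pt_def\<close>)
  \<comment> \<open>The point \<open>?p g\<close> equals
    \<open>pt m 0 (code_set m g) + (pt m 1 {} - pt m 0 {}) / 2\<close>, an affine combination of
    feasible points.\<close>
  have equations: "dot ?n a (?p g) = b" if g: "g \<in> ?G" and ab: "(a, b) \<in> E" for g a b
  proof -
    note S = code_set[OF g]
    have E: "dot ?n a x = b" if "x \<in> hard_polytope m" for x
    proof -
      have "x \<in> Q"
        using that PQ by auto
      then show ?thesis
        using ab unfolding Q by auto
    qed
    have "pt m 0 (code_set m g) \<in> hard_polytope m"
      using S by (intro pt_in_hard_polytope) auto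
    from E[OF this] E[OF zero] E[OF heavy] show ?thesis
      unfolding dot_pt[OF S(1)] dot_pt[OF empty_subsetI] by simp
  qed
  have cover: "?G \<subseteq> (\<Union>ab\<in>I. C ab)"
  proof
    fix g assume g: "g \<in> ?G"
    have "?p g \<in> Rn ?n"
      by (simp add: pt_def)
    then obtain a b where ab: "(a, b) \<in> I" "\<not> dot ?n a (?p g) \<le> b"
      using outside[OF g] equations[OF g] unfolding Q by blast
    then have "g \<in> C (a, b)"
      unfolding C_def using g by simp
    then show "g \<in> (\<Union>ab\<in>I. C ab)"
      using ab(1) by blast
  qed
  have intersecting: "m < card {i \<in> {..<2 * m}. g i = h i}"
    if ab: "(a, b) \<in> I" and gh: "g \<in> C (a, b)" "h \<in> C (a, b)" for a b g h
  proof (rule ccontr)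
    assume agree: "\<not> m < card {i \<in> {..<2 * m}. g i = h i}"
    have G: "g \<in> ?G" "h \<in> ?G"
      using gh by (auto simp: C_def)
    let ?S = "code_set m g" and ?T = "code_set m h"
    note S = code_set[OF G(1)] and T = code_set[OF G(2)]
    have fin: "finite ?S" "finite ?T"
      by (auto simp: code_set_def)
    have valid: "dot ?n a x \<le> b" if "x \<in> hard_polytope m" for x
    proof -
      have "x \<in> Q"
        using that PQ by auto
      then show ?thesis
        using ab unfolding Q by auto
    qed
    \<comment> \<open>Without item \<open>0\<close> the capacity \<open>4 m\<close> admits the whole
      union; with it, the remaining \<open>m\<close> admits the intersection.\<close>
    have "card (?S \<union> ?T) \<le> 4 * m"
      using card_Un_le[of ?S ?T] S T by simp
    then have "pt m 0 (?S \<union> ?T) \<in> hard_polytope m"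
      using S T by (intro pt_in_hard_polytope) auto
    from valid[OF this]
    have U: "(\<Sum>i\<in>?S \<union> ?T. Poly_Mapping.lookup a i) \<le> b"
      by (subst (asm) dot_pt) (use S(1) T(1) in auto)
    have "card (?S \<inter> ?T) \<le> m"
      using card_code_set_Int_le[OF G] agree by simp
    then have "pt m 1 (?S \<inter> ?T) \<in> hard_polytope m"
      using S T by (intro pt_in_hard_polytope) auto
    from valid[OF this]
    have V: "Poly_Mapping.lookup a 0 + (\<Sum>i\<in>?S \<inter> ?T. Poly_Mapping.lookup a i) \<le> b"
      by (subst (asm) dot_pt) (use S(1) in auto)
    have "b < dot ?n a (?p g)" "b < dot ?n a (?p h)"
      using gh by (auto simp: C_def)
    \<comment> \<open>The two violations add up to more than \<open>2 b\<close>, but the same sum,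
      regrouped by union and intersection, is at most \<open>2 b\<close>.\<close>
    with U V sum.union_inter[OF fin, of "Poly_Mapping.lookup a"] show False
      unfolding dot_pt[OF S(1)] dot_pt[OF T(1)] by linarith
  qed
  have card_C: "card (C ab) \<le> 64 ^ m" if "ab \<in> I" for ab
  proof -
    obtain a b where ab: "ab = (a, b)"
      by force
    \<comment> \<open>Here \<open>l = m\<close>: two functions cut off together differ in fewer than
      \<open>m\<close> of the \<open>2 m\<close> places.\<close>
    have "card (C ab) \<le> 2 ^ card {..<2 * m} * card {..<16::nat} ^ m"
    proof (rule card_intersecting_functions_le)
      show "card {..<2 * m} \<le> card {i \<in> {..<2 * m}. g i = h i} + m" if "g \<in> C ab" "h \<in> C ab" for g h
        using intersecting[of a b g h] that \<open>ab \<in> I\<close> ab by simp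
    qed (auto simp: C_def ab lessThan_empty_iff)
    also have "\<dots> = 4 ^ m * 16 ^ m"
      by (simp add: power_mult)
    also have "\<dots> = 64 ^ m"
      unfolding power_mult_distrib[symmetric] by simp
    finally show ?thesis .
  qed
  \<comment> \<open>There are \<open>16 ^ (2 * m) = 256 ^ m\<close> functions and each inequality
    accounts for at most \<open>64 ^ m\<close>, which leaves the factor
    \<open>4 ^ m\<close>.\<close>
  have "4 ^ m * 64 ^ m = (256::nat) ^ m"
    unfolding power_mult_distrib[symmetric] by simp
  also have "\<dots> = card ?G"
    unfolding card_PiE[OF finite_lessThan] by (simp add: power_mult)
  also have "\<dots> \<le> card (\<Union>ab\<in>I. C ab)"
  proof (rule card_mono[OF _ cover])
    have "finite ?G"
      by (intro finite_PiE) auto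
    then show "finite (\<Union>ab\<in>I. C ab)"
      using finI by (auto simp: C_def)
  qed
  also have "\<dots> \<le> (\<Sum>ab\<in>I. card (C ab))"
    by (rule card_UN_le[OF finI])
  also have "\<dots> \<le> card I * 64 ^ m"
    using sum_bounded_above[of I "\<lambda>ab. card (C ab)" "64 ^ m"] card_C by simp
  finally show ?thesis
    by simp
qed

section \<open>Polynomial against exponential growth\<close>

text \<open>The dimension \<open>32 * m + 1\<close> is linear in \<open>m\<close>, so a polynomial
  size bound eventually drops below \<open>4 ^ m\<close>. Each monomial is treated
  separately.\<close>

lemma poly_over_exp_tendsto_0:
  fixes p :: "real poly"
  assumes "c > 1"
  shows "(\<lambda>m. poly p (32 * real m + 1) / c ^ m) \<longlonglongrightarrow> 0"
proof -
  have "(\<lambda>m. coeff p i * (32 * real m + 1) ^ i / c ^ m) \<longlonglongrightarrow> 0" for i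
    using assms by real_asymp
  then have "(\<lambda>m. \<Sum>i\<le>degree p. coeff p i * (32 * real m + 1) ^ i / c ^ m) \<longlonglongrightarrow> 0"
    by (intro tendsto_null_sum)
  then show ?thesis
    by (simp add: poly_altdef sum_divide_distrib)
qed

theorem theorem1:
  shows "\<not> has_PSRS knapsack_family"
proof
  assume "has_PSRS knapsack_family"
  moreover have "(0::real) < 1 / 10"
    by simp
  ultimately obtain \<phi> where \<phi>: "polynomial_function \<phi>"
    and *: "\<And>n P. P \<in> knapsack_family n \<Longrightarrow>
      \<exists>Q. polytope Q \<and> approx_formulation n (1 / 10) P Q \<and> lin_size n Q \<le> enat (\<phi> n)"
    unfolding has_PSRS_def by blast
  obtain p :: "real poly" where p: "\<And>n. real (\<phi> n) = poly p (real n)"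
    using \<phi> by (auto simp: polynomial_function_def)
  have "eventually (\<lambda>m. poly p (32 * real m + 1) / 4 ^ m < 1) sequentially"
    using order_tendstoD(2)[OF poly_over_exp_tendsto_0[of 4 p], of 1] by simp
  then have "eventually (\<lambda>m. m > 0 \<and> poly p (32 * real m + 1) / 4 ^ m < 1) sequentially"
    using eventually_gt_at_top[of 0] by (rule eventually_conj[rotated])
  then obtain m where m: "m > 0" "poly p (32 * real m + 1) / 4 ^ m < 1"
    using eventually_happens'[OF sequentially_bot] by blast
  have "hard_polytope m \<in> knapsack_family (32 * m + 1)"
    by (force simp: knapsack_family_def hard_weight_def)
  from *[OF this] obtain Q E I where
    "polytope Q" "approx_formulation (32 * m + 1) (1 / 10) (hard_polytope m) Q"
    "linear_description (32 * m + 1) E I Q" "card I \<le> \<phi> (32 * m + 1)"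
    by (auto simp: lin_size_le_iff)
  with hard_polytope_size[OF m(1)] have "4 ^ m \<le> \<phi> (32 * m + 1)"
    using order_trans by blast
  then have "4 ^ m \<le> real (\<phi> (32 * m + 1))"
    by (metis of_nat_le_iff of_nat_numeral of_nat_power)
  with m(2) show False
    by (simp add: p add.commute)
qed

end
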